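(* Let $G$ be a connected Parter graph, and let $xy$ be a bridge of $G$. Let $G_1$ and $G_2$ be the two connected components of $G-xy$ (the graph obtained by deleting the edge $xy$), where $x\in V(G_1)$ and $y\in V(G_2)$. Then one of the following holds: (1) both $G_1$ and $G_2$ are Parter graphs; (2) both $G_1-x$ and $G_2-y$ are Parter graphs.
   Context: All graphs are finite and simple (not necessarily bipartite), and all matrices are real and symmetric. For a graph $G$ with vertex set $\{1,\dots,n\}$, let $S(G)$ be the set of real symmetric $n\times n$ matrices $A=(a_{ij})$ such that for all $i\neq j$, $a_{ij}\neq 0$ if and only if $ij$ is an edge of $G$ (diagonal entries are arbitrary). For a vertex $v$, $A(v)$ denotes the principal submatrix of $A$ obtained by deleting the row and column indexed by $v$. A graph $G$ is called a Parter graph if there exists a nonsingular matrix $A\in S(G)$ such that $\det A(v)=0$ for every vertex $v$ of $G$ (equivalently, all diagonal entries of $A^{-1}$ are zero). Convention: the empty ($0\times 0$) matrix has determinant $1$, so the graph with no vertices counts as a Parter graph (vacuously). $G-x$ denotes the graph obtained from $G$ by deleting the vertex $x$ together with all edges incident to $x$. *)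

theory Defs
  imports
    Complex_Main
    "Graph_Theory.Graph_Theory"
    "Jordan_Normal_Form.Determinant"
begin

text \<open>
  Finite simple graphs are the symmetric, loop-free digraphs without parallel arcs of the
  locale \<^locale>\<open>Digraph.graph\<close>; an undirected edge is a pair of opposite arcs.  The null
  graph is allowed there, but it is not connected in the sense of
  \<^const>\<open>Digraph_Component.connected\<close>.
\<close>

text \<open>
  The set \<open>S(G)\<close>.  Matrices have rows and columns \<open>0, \<dots>, n - 1\<close>, so \<open>G\<close> comes with a
  numbering \<open>f\<close> of its vertices, a bijection from \<open>{0..<n}\<close> to \<open>verts G\<close>.
\<close>

definition graph_matrices :: "('a, 'b) pre_digraph \<Rightarrow> (nat \<Rightarrow> 'a) \<Rightarrow> real mat set" where
  "graph_matrices G f =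
     {A \<in> carrier_mat (card (verts G)) (card (verts G)).
        transpose_mat A = A \<and>
        (\<forall>i < card (verts G). \<forall>j < card (verts G).
           i \<noteq> j \<longrightarrow> (A $$ (i, j) \<noteq> 0 \<longleftrightarrow> f i \<rightarrow>\<^bsub>G\<^esub> f j))}"

text \<open>
  Renumbering the vertices conjugates the matrices by a permutation matrix, so it does not matter
  whether the numbering is existentially or universally quantified.  The determinant of a
  \<open>0 \<times> 0\<close> matrix is 1, so the null graph is a Parter graph and a single vertex is not.
\<close>

definition parter_graph :: "('a, 'b) pre_digraph \<Rightarrow> bool" where
  "parter_graph G \<longleftrightarrow>
     Digraph.graph G \<and>
     (\<exists>f A. bij_betw f {0..<card (verts G)} (verts G) \<and>
        A \<in> graph_matrices G f \<and>
        det A \<noteq> 0 \<and>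
        (\<forall>i < card (verts G). det (mat_delete A i i) = 0))"

definition delete_edge :: "('a, 'b) pre_digraph \<Rightarrow> 'a \<Rightarrow> 'a \<Rightarrow> ('a, 'b) pre_digraph" where
  "delete_edge G x y = G\<lparr>arcs := {e \<in> arcs G. arc_to_ends G e \<notin> {(x, y), (y, x)}}\<rparr>"

definition connected_components :: "('a, 'b) pre_digraph \<Rightarrow> ('a, 'b) pre_digraph set" where
  "connected_components G =
     {H. pre_digraph.max_subgraph G Digraph_Component.connected H}"

definition bridge :: "('a, 'b) pre_digraph \<Rightarrow> 'a \<Rightarrow> 'a \<Rightarrow> bool" where
  "bridge G x y \<longleftrightarrow>
     x \<rightarrow>\<^bsub>G\<^esub> y \<and>
     card (connected_components G) < card (connected_components (delete_edge G x y))"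

end

theory Submission
  imports Defs
begin

text \<open>
  Let \<open>A\<close> be a nonsingular matrix of \<open>G\<close> whose \<open>det A(v)\<close> all vanish, with diagonal blocks \<open>A\<^sub>1\<close> and
  \<open>A\<^sub>2\<close> on \<open>G\<^sub>1\<close> and \<open>G\<^sub>2\<close>, and with the entry \<open>c \<noteq> 0\<close> at the bridge. Expanding over permutations gives
  \<open>det A = det A\<^sub>1 \<cdot> det A\<^sub>2 - c\<^sup>2 \<cdot> det A\<^sub>1(x) \<cdot> det A\<^sub>2(y)\<close>, and likewise with a vertex
  other than \<open>x\<close> and \<open>y\<close> deleted. Deleting \<open>x\<close>, respectively \<open>y\<close>, destroys the bridge and yields
  \<open>det A\<^sub>1(x) \<cdot> det A\<^sub>2 = 0\<close>, respectively \<open>det A\<^sub>1 \<cdot> det A\<^sub>2(y) = 0\<close>, so by nonsingularity exactly one of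
  the two products in \<open>det A\<close> is nonzero and both factors of the other one vanish. Deleting the other
  vertices then shows that either \<open>A\<^sub>1\<close> and \<open>A\<^sub>2\<close>, or \<open>A\<^sub>1(x)\<close> and \<open>A\<^sub>2(y)\<close>, have the Parter property.
\<close>

section \<open>Determinants indexed by finite sets\<close>

text \<open>This is the Leibniz formula over an arbitrary index set. A principal submatrix is then a
  smaller set with the same entry function \<open>a\<close>, so deleting vertices requires no
  renumbering. On the empty set the value is 1, in agreement with the convention for the null
  graph.\<close>

definition det_on :: "'a set \<Rightarrow> ('a \<Rightarrow> 'a \<Rightarrow> 'c) \<Rightarrow> 'c :: comm_ring_1" where
  "det_on S a = (\<Sum>p | p permutes S. of_int (sign p) * (\<Prod>i\<in>S. a i (p i)))"

text \<open>Transport along the numbering \<open>f\<close> is a sign-preserving bijection from the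
  permutations of \<open>{0..<n}\<close> to those of \<open>V\<close>, and it matches the Leibniz
  products term by term.\<close>

lemma det_eq_det_on:
  assumes A: "A \<in> carrier_mat n n"
    and f: "bij_betw f {0..<n} V"
    and a: "\<And>i j. i < n \<Longrightarrow> j < n \<Longrightarrow> A $$ (i, j) = a (f i) (f j)"
  shows "det A = det_on V a"
proof -
  let ?N = "{0..<n}"
  have inj: "inj_on f ?N" and img: "f ` ?N = V"
    using f by (auto simp: bij_betw_def)
  \<comment> \<open>This is the explicit form in which \<open>bij_betw_permutations\<close>
    describes the bijection.\<close>
  have "map_permutation ?N f =
      (\<lambda>p x. if x \<in> V then f (p (inv_into ?N f x)) else x)"
    by (auto simp: map_permutation_def restrict_id_def img fun_eq_iff)
  then have bij: "bij_betw (map_permutation ?N f) {p. p permutes ?N} {p. p permutes V}"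
    using bij_betw_permutations[OF f] by simp
  have "det_on V a = (\<Sum>p | p permutes ?N. of_int (sign (map_permutation ?N f p)) *
      (\<Prod>v\<in>V. a v (map_permutation ?N f p v)))"
    unfolding det_on_def by (rule sum.reindex_bij_betw[OF bij, symmetric])
  also have "\<dots> = (\<Sum>p | p permutes ?N. of_int (sign p) * (\<Prod>i = 0..<n. A $$ (i, p i)))"
  proof (intro sum.cong refl)
    fix p assume "p \<in> {p. p permutes ?N}"
    then have p: "p permutes ?N" by simp
    have "(\<Prod>v\<in>V. a v (map_permutation ?N f p v)) =
        (\<Prod>i\<in>?N. a (f i) (map_permutation ?N f p (f i)))"
      by (rule prod.reindex_bij_betw[OF f, symmetric])
    also have "\<dots> = (\<Prod>i\<in>?N. A $$ (i, p i))"
    proof (intro prod.cong refl)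
      fix i assume i: "i \<in> ?N"
      then have "p i \<in> ?N" using permutes_in_image[OF p] by blast
      then show "a (f i) (map_permutation ?N f p (f i)) = A $$ (i, p i)"
        using i a by (simp add: map_permutation_apply[OF inj])
    qed
    finally show "of_int (sign (map_permutation ?N f p)) * (\<Prod>v\<in>V. a v (map_permutation ?N f p v))
        = of_int (sign p) * (\<Prod>i = 0..<n. A $$ (i, p i))"
      by (simp add: sign_map_permutation[OF inj p])
  qed
  also have "\<dots> = det A" by (rule det_def'[OF A, symmetric])
  finally show ?thesis by simp
qed

text \<open>Deleting row and column \<open>i\<close> reindexes by \<open>insert_index i\<close>,
  which skips \<open>i\<close>. Composed with \<open>f\<close> it is a numbering of
  \<open>V - {f i}\<close>.\<close>

lemma det_mat_delete_eq_det_on: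
  assumes A: "A \<in> carrier_mat n n"
    and f: "bij_betw f {0..<n} V"
    and a: "\<And>i j. i < n \<Longrightarrow> j < n \<Longrightarrow> A $$ (i, j) = a (f i) (f j)"
    and i: "i < n"
  shows "det (mat_delete A i i) = det_on (V - {f i}) a"
proof (rule det_eq_det_on)
  obtain m where n: "n = Suc m" using i by (cases n) auto
  show "mat_delete A i i \<in> carrier_mat (n - 1) (n - 1)"
    by (rule mat_delete_carrier[OF A])
  have "bij_betw (insert_index i) {0..<m} ({0..<n} - {i})"
    using insert_index_image[of i m] i n insert_index_inj_on by (auto simp: bij_betw_def)
  moreover have "bij_betw f ({0..<n} - {i}) (V - {f i})"
    using f i by (auto simp: bij_betw_def inj_on_def)
  ultimately show "bij_betw (f \<circ> insert_index i) {0..<n - 1} (V - {f i})"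
    using n by (auto intro: bij_betw_trans)
  show "mat_delete A i i $$ (k, l) = a ((f \<circ> insert_index i) k) ((f \<circ> insert_index i) l)"
    if "k < n - 1" "l < n - 1" for k l
    using that a A i n by (simp add: mat_delete_def insert_index_def)
qed

section \<open>Leibniz sums over permutations that respect a splitting of the index set\<close>

text \<open>By finiteness a permutation that maps \<open>S\<close> into itself maps \<open>S\<close>
  onto itself, hence also \<open>T\<close> onto itself. It is therefore the product of its
  restrictions to the two blocks, and these are unique.\<close>

lemma bij_betw_permutes_Un:
  assumes disj: "S \<inter> T = {}" and fin: "finite S" "finite T"
  shows "bij_betw (\<lambda>(q, r). q \<circ> r) ({q. q permutes S} \<times> {r. r permutes T})
    {p. p permutes S \<union> T \<and> p ` S \<subseteq> S}"
proof (rule bij_betwI[where g = "\<lambda>p. (restrict_id p S, restrict_id p T)"])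
  show "(\<lambda>(q, r). q \<circ> r) \<in> {q. q permutes S} \<times> {r. r permutes T} \<rightarrow>
      {p. p permutes S \<union> T \<and> p ` S \<subseteq> S}"
  proof clarsimp
    fix q r assume qr: "q permutes S" "r permutes T"
    have "q \<circ> r permutes S \<union> T"
      using qr by (meson permutes_compose permutes_subset sup_ge1 sup_ge2)
    moreover have "(\<lambda>u. q (r u)) ` S \<subseteq> S"
      using qr disj by (auto simp: permutes_in_image permutes_not_in disjoint_iff)
    ultimately show "q \<circ> r permutes S \<union> T \<and> (\<lambda>x. q (r x)) ` S \<subseteq> S" by simp
  qed
  have bij: "bij_betw p S S \<and> bij_betw p T T" if "p permutes S \<union> T" "p ` S \<subseteq> S" for p
  proof -
    have inj: "inj p" by (rule permutes_inj[OF that(1)])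
    then have S: "p ` S = S"
      using that(2) fin by (simp add: endo_inj_surj inj_on_subset)
    have "p ` ((S \<union> T) - S) = p ` (S \<union> T) - p ` S"
      by (rule image_set_diff[OF inj])
    then have "p ` T = T"
      using disj by (simp add: permutes_image[OF that(1)] S Un_Diff Diff_triv Int_commute)
    then show ?thesis using S inj by (auto simp: bij_betw_def intro: inj_on_subset)
  qed
  show "(\<lambda>p. (restrict_id p S, restrict_id p T)) \<in> {p. p permutes S \<union> T \<and> p ` S \<subseteq> S} \<rightarrow>
      {q. q permutes S} \<times> {r. r permutes T}"
    using bij by (auto intro: permutes_restrict_id)
  show "(restrict_id ((case qr of (q, r) \<Rightarrow> q \<circ> r)) S, restrict_id (case qr of (q, r) \<Rightarrow> q \<circ> r) T) = qr"
    if mem: "qr \<in> {q. q permutes S} \<times> {r. r permutes T}" for qr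
  proof -
    obtain q r where qr: "qr = (q, r)" "q permutes S" "r permutes T"
      using mem by (cases qr) auto
    have "restrict_id (q \<circ> r) S = q" "restrict_id (q \<circ> r) T = r"
      using qr disj
      by (auto simp: fun_eq_iff restrict_id_def permutes_in_image permutes_not_in disjoint_iff
        intro!: permutes_not_in[OF qr(2)])
    then show ?thesis using qr by simp
  qed
  show "(case (restrict_id p S, restrict_id p T) of (q, r) \<Rightarrow> q \<circ> r) = p"
    if "p \<in> {p. p permutes S \<union> T \<and> p ` S \<subseteq> S}" for p
  proof -
    have "p u \<in> T" if "u \<in> T" for u
      using bij[of p] \<open>p \<in> _\<close> that by (auto simp: bij_betw_def)
    then show ?thesis
      using that disj
      by (auto simp: fun_eq_iff restrict_id_def permutes_not_in disjoint_iff)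
  qed
qed

text \<open>For \<open>q \<circ> r\<close> with \<open>q\<close> on \<open>S\<close> and
  \<open>r\<close> on \<open>T\<close> the sign is multiplicative, and each block of the product
  sees only one of the two factors. No entry has to vanish here: the sum is already restricted to
  block permutations.\<close>

lemma sum_block_permutations:
  assumes disj: "S \<inter> T = {}" and fin: "finite S" "finite T"
  shows "(\<Sum>p | p permutes S \<union> T \<and> p ` S \<subseteq> S. of_int (sign p) * (\<Prod>i\<in>S \<union> T. a i (p i))) =
    det_on S a * det_on T a"
proof -
  have "(\<Sum>p | p permutes S \<union> T \<and> p ` S \<subseteq> S. of_int (sign p) * (\<Prod>i\<in>S \<union> T. a i (p i))) =
    (\<Sum>(q, r)\<in>{q. q permutes S} \<times> {r. r permutes T}.
      of_int (sign (q \<circ> r)) * (\<Prod>i\<in>S \<union> T. a i ((q \<circ> r) i)))"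
    by (subst sum.reindex_bij_betw[OF bij_betw_permutes_Un[OF assms], symmetric])
      (simp add: case_prod_unfold)
  also have "\<dots> = (\<Sum>(q, r)\<in>{q. q permutes S} \<times> {r. r permutes T}.
      (of_int (sign q) * (\<Prod>i\<in>S. a i (q i))) * (of_int (sign r) * (\<Prod>i\<in>T. a i (r i))))"
  proof (intro sum.cong refl, clarify)
    fix q r assume q: "q permutes S" and r: "r permutes T"
    have "(\<Prod>i\<in>S \<union> T. a i ((q \<circ> r) i)) = (\<Prod>i\<in>S. a i ((q \<circ> r) i)) * (\<Prod>i\<in>T. a i ((q \<circ> r) i))"
      using assms by (simp add: prod.union_disjoint)
    also have "(\<Prod>i\<in>S. a i ((q \<circ> r) i)) = (\<Prod>i\<in>S. a i (q i))"
      using r disj by (intro prod.cong) (auto simp: permutes_not_in disjoint_iff)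
    also have "(\<Prod>i\<in>T. a i ((q \<circ> r) i)) = (\<Prod>i\<in>T. a i (r i))"
      using q r disj
      by (intro prod.cong) (auto simp: permutes_not_in permutes_in_image disjoint_iff
        intro!: arg_cong[of _ _ "a _"] permutes_not_in[OF q])
    finally show "of_int (sign (q \<circ> r)) * (\<Prod>i\<in>S \<union> T. a i ((q \<circ> r) i)) =
        of_int (sign q) * (\<Prod>i\<in>S. a i (q i)) * (of_int (sign r) * (\<Prod>i\<in>T. a i (r i)))"
      using permutes_imp_permutation[OF fin(1) q] permutes_imp_permutation[OF fin(2) r]
      by (simp add: sign_compose)
  qed
  also have "\<dots> = det_on S a * det_on T a"
    by (simp add: det_on_def sum_product sum.cartesian_product)
  finally show ?thesis .
qed

text \<open>A permutation that does not preserve \<open>S\<close> sends some row of \<open>S\<close>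
  to a column of \<open>T\<close> and so picks a zero entry. Zeros on one side suffice.\<close>

lemma det_on_block_triangular:
  assumes disj: "S \<inter> T = {}" and fin: "finite S" "finite T"
    and zero: "\<And>u v. u \<in> S \<Longrightarrow> v \<in> T \<Longrightarrow> a u v = 0"
  shows "det_on (S \<union> T) a = det_on S a * det_on T a"
proof -
  have "det_on (S \<union> T) a =
      (\<Sum>p | p permutes S \<union> T \<and> p ` S \<subseteq> S. of_int (sign p) * (\<Prod>i\<in>S \<union> T. a i (p i)))"
    unfolding det_on_def
  proof (intro sum.mono_neutral_right ballI)
    fix p assume "p \<in> {p. p permutes S \<union> T} - {p. p permutes S \<union> T \<and> p ` S \<subseteq> S}"
    then obtain u where "p permutes S \<union> T" "u \<in> S" "p u \<notin> S" by auto
    moreover from this have "p u \<in> T" by (metis UnE UnI1 permutes_in_image)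
    ultimately have "(\<Prod>i\<in>S \<union> T. a i (p i)) = 0"
      using fin zero by (intro prod_zero) auto
    then show "of_int (sign p) * (\<Prod>i\<in>S \<union> T. a i (p i)) = 0" by simp
  qed (use fin in \<open>auto simp: finite_permutations\<close>)
  then show ?thesis using sum_block_permutations[OF disj fin] by simp
qed

text \<open>Composing with the transposition of \<open>x\<close> and \<open>y\<close> turns these
  permutations into block permutations of \<open>S - {x}\<close> and \<open>T - {y}\<close>. The
  sign changes, which gives the minus, and the entries at \<open>(x, y)\<close> and
  \<open>(y, x)\<close> split off.\<close>

lemma sum_link_permutations:
  assumes disj: "S \<inter> T = {}" and fin: "finite S" "finite T" and xy: "x \<in> S" "y \<in> T"
  shows "(\<Sum>p | p permutes S \<union> T \<and> p x = y \<and> p y = x \<and> p ` (S - {x}) \<subseteq> S - {x}.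
      of_int (sign p) * (\<Prod>i\<in>S \<union> T. a i (p i))) =
    - (a x y * a y x * det_on (S - {x}) a * det_on (T - {y}) a)"
    (is "sum ?term ?B = _")
proof -
  let ?S = "S - {x}" and ?T = "T - {y}" and ?t = "Transposition.transpose x y"
  let ?A = "{p. p permutes ?S \<union> ?T \<and> p ` ?S \<subseteq> ?S}"
  have xy_neq: "x \<noteq> y" "y \<notin> S" "x \<notin> T" using disj xy by auto
  have fixes_xy: "p x = x" "p y = y" if "p permutes ?S \<union> ?T" for p
    using that xy_neq by (auto simp: permutes_not_in)
  \<comment> \<open>The transposition is an involution, so the same map serves as inverse.\<close>
  have bij: "bij_betw (\<lambda>p. p \<circ> ?t) ?A ?B"
  proof (rule bij_betwI[where g = "\<lambda>p. p \<circ> ?t"])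
    show "(\<lambda>p. p \<circ> ?t) \<in> ?A \<rightarrow> ?B"
    proof
      fix p assume p: "p \<in> ?A"
      have "p permutes S \<union> T" using p by (auto intro: permutes_subset)
      then have "p \<circ> ?t permutes S \<union> T"
        using xy by (intro permutes_compose permutes_swap_id) auto
      moreover have "(p \<circ> ?t) ` (S - {x}) = p ` (S - {x})"
        using xy_neq by (intro image_cong) (auto simp: transpose_def)
      ultimately show "p \<circ> ?t \<in> ?B"
        using p fixes_xy[of p] by simp
    qed
    show "(\<lambda>p. p \<circ> ?t) \<in> ?B \<rightarrow> ?A"
    proof
      fix p assume p: "p \<in> ?B"
      have "p \<circ> ?t permutes S \<union> T"
        using p xy by (intro permutes_compose permutes_swap_id) auto
      \<comment> \<open>Since \<open>p\<close> swaps \<open>x\<close> and \<open>y\<close>, the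
        composition fixes both, and its support shrinks accordingly.\<close>
      then have "p \<circ> ?t permutes ?S \<union> ?T"
        by (rule permutes_superset) (use p in auto)
      moreover have "(p \<circ> ?t) ` (S - {x}) = p ` (S - {x})"
        using xy_neq by (intro image_cong) (auto simp: transpose_def)
      ultimately show "p \<circ> ?t \<in> ?A"
        using p by simp
    qed
  qed (auto simp: comp_assoc)
  have "sum ?term ?B = (\<Sum>p\<in>?A. ?term (p \<circ> ?t))"
    by (rule sum.reindex_bij_betw[OF bij, symmetric])
  also have "\<dots> = (\<Sum>p\<in>?A. - (a x y * a y x) * (of_int (sign p) * (\<Prod>i\<in>?S \<union> ?T. a i (p i))))"
  proof (intro sum.cong refl)
    fix p assume "p \<in> ?A"
    then have p: "p permutes ?S \<union> ?T" by simp
    have perm: "permutation p"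
      using permutes_imp_permutation[OF _ p] fin by blast
    have sgn: "sign (p \<circ> ?t) = - sign p"
      using xy_neq by (simp add: sign_compose[OF perm permutation_swap_id] sign_swap_id)
    have un: "S \<union> T = insert x (insert y (?S \<union> ?T))" using xy by auto
    have "(\<Prod>i\<in>S \<union> T. a i ((p \<circ> ?t) i)) = a x y * (a y x * (\<Prod>i\<in>?S \<union> ?T. a i ((p \<circ> ?t) i)))"
      unfolding un using xy_neq fin fixes_xy[OF p] by simp
    also have "(\<Prod>i\<in>?S \<union> ?T. a i ((p \<circ> ?t) i)) = (\<Prod>i\<in>?S \<union> ?T. a i (p i))"
      using xy_neq by (intro prod.cong) (auto simp: transpose_def)
    finally show "?term (p \<circ> ?t) =
        - (a x y * a y x) * (of_int (sign p) * (\<Prod>i\<in>?S \<union> ?T. a i (p i)))"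
      by (simp add: sgn algebra_simps)
  qed
  also have "\<dots> = - (a x y * a y x) * (det_on ?S a * det_on ?T a)"
    by (subst sum_distrib_left[symmetric], subst sum_block_permutations) (use disj fin in auto)
  finally show ?thesis by (simp add: mult.assoc)
qed

text \<open>In a nonzero term the only way from \<open>S\<close> to \<open>T\<close> is from
  \<open>x\<close> to \<open>y\<close>, and the only way back is from \<open>y\<close> to
  \<open>x\<close>. By finiteness a permutation that leaves \<open>S\<close> must also return, so it
  uses both or neither. The two cases are \<open>?B\<close> and \<open>?A\<close>.\<close>

lemma det_on_single_link:
  assumes disj: "S \<inter> T = {}" and fin: "finite S" "finite T" and xy: "x \<in> S" "y \<in> T"
    and zero: "\<And>u v. u \<in> S \<Longrightarrow> v \<in> T \<Longrightarrow> (u, v) \<noteq> (x, y) \<Longrightarrow> a u v = 0 \<and> a v u = 0"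
  shows "det_on (S \<union> T) a = det_on S a * det_on T a -
    a x y * a y x * det_on (S - {x}) a * det_on (T - {y}) a"
proof -
  let ?A = "{p. p permutes S \<union> T \<and> p ` S \<subseteq> S}"
  let ?B = "{p. p permutes S \<union> T \<and> p x = y \<and> p y = x \<and> p ` (S - {x}) \<subseteq> S - {x}}"
  let ?term = "\<lambda>p. of_int (sign p) * (\<Prod>i\<in>S \<union> T. a i (p i))"
  have fins: "finite {p. p permutes S \<union> T}" using fin by (simp add: finite_permutations)
  have "det_on (S \<union> T) a = sum ?term (?A \<union> ?B)"
    unfolding det_on_def
  proof (intro sum.mono_neutral_right ballI)
    fix p assume "p \<in> {p. p permutes S \<union> T} - (?A \<union> ?B)"
    then have p: "p permutes S \<union> T" and nA: "\<not> p ` S \<subseteq> S" and nB: "p \<notin> ?B" by auto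
    have inj: "inj p" by (rule permutes_inj[OF p])
    have pin: "p u \<in> S \<union> T" if "u \<in> S \<union> T" for u
      using permutes_in_image[OF p] that by blast
    have "\<exists>u\<in>S \<union> T. a u (p u) = 0"
    proof (rule ccontr)
      assume "\<not> ?thesis"
      then have nz: "\<And>u. u \<in> S \<union> T \<Longrightarrow> a u (p u) \<noteq> 0" by blast
      have ST: "u = x \<and> p u = y" if "u \<in> S" "p u \<in> T" for u
        using zero[of u "p u"] nz[of u] that by auto
      have TS: "u = y \<and> p u = x" if "u \<in> T" "p u \<in> S" for u
        using zero[of "p u" u] nz[of u] that by auto
      obtain u where "u \<in> S" "p u \<notin> S" using nA by auto
      then have px: "p x = y" using ST[of u] pin[of u] by auto
      \<comment> \<open>Otherwise \<open>p\<close> would map \<open>T\<close> onto \<open>T\<close>,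
        and \<open>y\<close> would have a preimage in \<open>T\<close> besides its preimage
        \<open>x\<close> in \<open>S\<close>.\<close>
      have "\<not> p ` T \<subseteq> T"
      proof
        assume "p ` T \<subseteq> T"
        then have "p ` T = T" using inj fin by (simp add: endo_inj_surj inj_on_subset)
        then obtain v where "v \<in> T" "p v = y" using xy by (metis imageE)
        then show False using px inj disj xy by (metis disjoint_iff injD)
      qed
      then obtain v where "v \<in> T" "p v \<notin> T" by auto
      then have py: "p y = x" using TS[of v] pin[of v] by auto
      have "p u \<in> S - {x}" if "u \<in> S - {x}" for u
      proof -
        have "p u \<notin> T" using ST[of u] that by auto
        moreover have "p u \<noteq> x" using py inj that disj xy by (metis DiffD1 disjoint_iff injD)
        ultimately show ?thesis using pin[of u] that by auto
      qed
      then show False using nB p px py by auto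
    qed
    then have "(\<Prod>i\<in>S \<union> T. a i (p i)) = 0"
      using fin by (intro prod_zero) auto
    then show "?term p = 0" by simp
  qed (use fins in auto)
  also have "\<dots> = sum ?term ?A + sum ?term ?B"
  proof (rule sum.union_disjoint)
    show "finite ?A" "finite ?B" using fins by (auto intro: finite_subset)
    show "?A \<inter> ?B = {}" using disj xy by blast
  qed
  finally show ?thesis
    by (simp add: sum_block_permutations[OF disj fin] sum_link_permutations[OF disj fin xy])
qed

section \<open>Parter graphs\<close>

text \<open>A numbering and a matrix amount to an entry function on pairs of vertices. In this form
  the entries of one graph can be reused unchanged on its subgraphs.\<close>

lemma parter_graph_iff:
  fixes G :: "('a, 'b) pre_digraph"
  shows "parter_graph G \<longleftrightarrow> Digraph.graph G \<and> (\<exists>a :: 'a \<Rightarrow> 'a \<Rightarrow> real.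
    (\<forall>u\<in>verts G. \<forall>v\<in>verts G. a u v = a v u \<and> (u \<noteq> v \<longrightarrow> (a u v \<noteq> 0 \<longleftrightarrow> u \<rightarrow>\<^bsub>G\<^esub> v))) \<and>
    det_on (verts G) a \<noteq> 0 \<and> (\<forall>v\<in>verts G. det_on (verts G - {v}) a = 0))"
    (is "_ \<longleftrightarrow> _ \<and> (\<exists>a. ?P a)")
proof
  assume "parter_graph G"
  let ?n = "card (verts G)"
  obtain f A where G: "Digraph.graph G" and f: "bij_betw f {0..<?n} (verts G)"
    and A: "A \<in> graph_matrices G f" and det: "det A \<noteq> 0" "\<And>i. i < ?n \<Longrightarrow> det (mat_delete A i i) = 0"
    using \<open>parter_graph G\<close> unfolding parter_graph_def by auto
  have carrier: "A \<in> carrier_mat ?n ?n" and sym: "transpose_mat A = A"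
    and adj: "\<And>i j. i < ?n \<Longrightarrow> j < ?n \<Longrightarrow> i \<noteq> j \<Longrightarrow> A $$ (i, j) \<noteq> 0 \<longleftrightarrow> f i \<rightarrow>\<^bsub>G\<^esub> f j"
    using A unfolding graph_matrices_def by auto
  \<comment> \<open>The entries are pulled back along the inverse of the numbering; the values
    outside \<open>verts G\<close> are irrelevant.\<close>
  define a where "a u v = A $$ (inv_into {0..<?n} f u, inv_into {0..<?n} f v)" for u v
  have a: "A $$ (i, j) = a (f i) (f j)" if "i < ?n" "j < ?n" for i j
    using that f by (simp add: a_def bij_betw_inv_into_left)
  have obt: "\<exists>i<?n. u = f i" if "u \<in> verts G" for u
    using that f by (force simp: bij_betw_def)
  have "A $$ (i, j) = A $$ (j, i)" if "i < ?n" "j < ?n" for i j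
    using that carrier by (metis carrier_matD index_transpose_mat(1) sym)
  then have "a u v = a v u \<and> (u \<noteq> v \<longrightarrow> (a u v \<noteq> 0 \<longleftrightarrow> u \<rightarrow>\<^bsub>G\<^esub> v))"
    if "u \<in> verts G" "v \<in> verts G" for u v
    using obt[OF that(1)] obt[OF that(2)] a adj by metis
  moreover have "det_on (verts G) a \<noteq> 0"
    using det det_eq_det_on[OF carrier f, of a] a by simp
  moreover have "det_on (verts G - {v}) a = 0" if "v \<in> verts G" for v
    using obt[OF that] det det_mat_delete_eq_det_on[OF carrier f, of a] a by auto
  ultimately show "Digraph.graph G \<and> (\<exists>a. ?P a)" using G by blast
next
  assume "Digraph.graph G \<and> (\<exists>a. ?P a)"
  then obtain a where G: "Digraph.graph G" and a: "?P a" by blast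
  let ?n = "card (verts G)"
  interpret Digraph.graph G by (rule G)
  obtain f where f: "bij_betw f {0..<?n} (verts G)"
    using ex_bij_betw_nat_finite[OF finite_verts] by blast
  define A where "A = mat ?n ?n (\<lambda>(i, j). a (f i) (f j))"
  have carrier: "A \<in> carrier_mat ?n ?n" by (simp add: A_def)
  have entry: "A $$ (i, j) = a (f i) (f j)" if "i < ?n" "j < ?n" for i j
    using that by (simp add: A_def)
  have fv: "f i \<in> verts G" if "i < ?n" for i
    using f that by (auto simp: bij_betw_def)
  have fneq: "f i \<noteq> f j" if "i < ?n" "j < ?n" "i \<noteq> j" for i j
    using f that by (auto simp: bij_betw_def inj_on_def)
  have "transpose_mat A = A"
    using a fv by (intro eq_matI) (auto simp: A_def)
  then have "A \<in> graph_matrices G f"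
    using carrier a fv fneq entry by (simp add: graph_matrices_def)
  moreover have "det A \<noteq> 0"
    using a det_eq_det_on[OF carrier f, of a] entry by simp
  moreover have "det (mat_delete A i i) = 0" if "i < ?n" for i
    using a det_mat_delete_eq_det_on[OF carrier f, of a] entry fv that by simp
  ultimately show "parter_graph G" using G f unfolding parter_graph_def by blast
qed

lemma parter_graphI:
  fixes a :: "'a \<Rightarrow> 'a \<Rightarrow> real"
  assumes "Digraph.graph G"
    and "\<And>u v. u \<in> verts G \<Longrightarrow> v \<in> verts G \<Longrightarrow> a u v = a v u"
    and "\<And>u v. u \<in> verts G \<Longrightarrow> v \<in> verts G \<Longrightarrow> u \<noteq> v \<Longrightarrow> a u v \<noteq> 0 \<longleftrightarrow> u \<rightarrow>\<^bsub>G\<^esub> v"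
    and "det_on (verts G) a \<noteq> 0"
    and "\<And>v. v \<in> verts G \<Longrightarrow> det_on (verts G - {v}) a = 0"
  shows "parter_graph G"
  using assms unfolding parter_graph_iff by blast

section \<open>Components after deletion of a bridge\<close>

text \<open>Both opposite arcs disappear together, so symmetry is preserved.\<close>

lemma (in graph) graph_delete_edge: "Digraph.graph (delete_edge G u v)"
proof -
  have "subgraph (delete_edge G u v) G"
    by (auto simp: subgraph_def delete_edge_def compatible_def wf_digraph wf_digraph_def)
  then interpret D: digraph "delete_edge G u v" by (rule digraph_subgraph)
  have "symmetric (delete_edge G u v)"
    using sym_arcs by (fastforce simp: symmetric_conv delete_edge_def arc_to_ends_def)
  then show ?thesis by (rule D.graphI)
qed

lemma arcs_ends_delete_edge: "arcs_ends (delete_edge G u v) = arcs_ends G - {(u, v), (v, u)}"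
  by (auto simp: arcs_ends_def delete_edge_def arc_to_ends_def)

lemma (in graph) graph_induced_subgraph:
  assumes "induced_subgraph H G"
  shows "Digraph.graph H"
proof -
  interpret H: digraph H
    using assms by (intro digraph_subgraph induced_imp_subgraph)
  show ?thesis
    by (rule H.graphI) (rule induced_graph_imp_symmetric[OF sym_arcs assms])
qed

lemma arcs_ends_induced_subgraph:
  assumes "induced_subgraph H G"
  shows "arcs_ends H = {(u, v) \<in> arcs_ends G. u \<in> verts H \<and> v \<in> verts H}"
  using assms by (auto simp: induced_subgraph_def subgraph_def compatible_def arcs_ends_conv)

lemma (in wf_digraph) induced_subgraph_del_vert: "induced_subgraph (del_vert v) G"
  by (auto simp: induced_subgraph_def subgraph_del_vert del_vert_simps)

section \<open>Connected components as strongly connected components\<close>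

lemma strongly_connected_imp_connected:
  assumes "strongly_connected G"
  shows "Digraph_Component.connected G"
proof -
  have "arcs_ends G \<subseteq> (arcs_ends G)\<^sup>s" by (auto simp: symcl_def)
  then show ?thesis
    using assms unfolding connected_conv strongly_connected_def reachable_def
    by (meson order_refl rtrancl_on_mono)
qed

text \<open>Adding arcs on a fixed vertex set keeps a digraph connected. This is what makes maximal
  connected subgraphs induced.\<close>

lemma arc_mono_connected: "arc_mono Digraph_Component.connected"
  unfolding arc_mono_def
  by (metis spanning_def subgraphE wf_digraph.connected_spanning_imp_connected)

lemma (in graph) connected_induced_subgraph_imp_strongly_connected:
  assumes "induced_subgraph H G" "Digraph_Component.connected H"
  shows "strongly_connected H"
proof -
  interpret H: Digraph.graph H by (rule graph_induced_subgraph[OF assms(1)])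
  show ?thesis by (rule H.symmetric_connected_imp_strongly_connected[OF H.sym_arcs assms(2)])
qed

text \<open>A subgraph of a symmetric digraph may contain an arc without its opposite, so the two
  notions can differ on subgraphs. They agree on induced subgraphs, and maximality allows passing to
  those. The equality gives access to the theory of \<open>sccs\<close>.\<close>

lemma (in graph) connected_components_eq_sccs: "connected_components G = sccs"
proof -
  have "max_subgraph strongly_connected H" if "max_subgraph Digraph_Component.connected H" for H
  proof (rule max_subgraph_mp[OF that strongly_connected_imp_connected])
    have "induced_subgraph H G"
      by (rule induced_subgraphI_arc_mono[OF that arc_mono_connected])
    then show "strongly_connected H"
      using that max_subgraph_prop connected_induced_subgraph_imp_strongly_connected by blast
  qed
  moreover have "max_subgraph Digraph_Component.connected H"
    if H: "max_subgraph strongly_connected H" for H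
  proof (rule max_subgraphI)
    show "Digraph_Component.connected H"
      using H max_subgraph_prop strongly_connected_imp_connected by blast
    show "subgraph H G" by (rule subgraphI_max_subgraph[OF H])
    fix K assume K: "H \<noteq> K" "subgraph H K" "subgraph K G"
    \<comment> \<open>A connected \<open>K\<close> properly above \<open>H\<close> is enlarged to
      the induced subgraph on its vertices, which is strongly connected. Maximality of
      \<open>H\<close> then collapses it to \<open>H\<close>.\<close>
    let ?I = "G \<restriction> verts K"
    have KI: "subgraph K ?I" by (rule subgraph_induce_subgraphI2[OF K(3)])
    have I: "induced_subgraph ?I G"
      using K(3) by (intro induced_induce) auto
    show "\<not> Digraph_Component.connected K"
    proof
      assume "Digraph_Component.connected K"
      then have "Digraph_Component.connected ?I"
        using arc_mono_connected KI unfolding arc_mono_def by (metis induce_subgraph_verts)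
      then have "strongly_connected ?I"
        by (rule connected_induced_subgraph_imp_strongly_connected[OF I])
      moreover have "subgraph H ?I" by (rule subgraph_trans[OF K(2) KI])
      ultimately have "?I = H"
        using H I induced_imp_subgraph unfolding max_subgraph_def by blast
      then have "subgraph K H" using KI by simp
      then show False
        using K(1,2) by (auto simp: subgraph_def compatible_def)
    qed
  qed
  ultimately show ?thesis by (auto simp: connected_components_def sccs_altdef2)
qed

text \<open>The component of \<open>u\<close> is induced by the vertices reachable from
  \<open>u\<close>, and \<open>v\<close> is one of them.\<close>

lemma (in graph) adj_imp_mem_same_scc:
  assumes "u \<rightarrow>\<^bsub>G\<^esub> v"
  obtains H where "H \<in> sccs" "u \<in> verts H" "v \<in> verts H"
proof -
  have "u \<in> verts G" using assms by (rule adj_in_verts)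
  then show ?thesis
    using that[OF induce_reachable_is_in_sccs[of u]] assms by auto
qed

text \<open>These are the graph-theoretic facts that the determinant argument needs. The components
  of the graph without the bridge are induced, disjoint and cover all vertices, and no remaining arc
  joins them.\<close>

lemma (in graph) bridge_components:
  assumes conn: "Digraph_Component.connected G" and bridge: "bridge G x y"
    and comps: "connected_components (delete_edge G x y) = {G1, G2}"
    and xy: "x \<in> verts G1" "y \<in> verts G2"
  shows "Digraph.graph G1" "Digraph.graph G2"
    and "verts G = verts G1 \<union> verts G2" "verts G1 \<inter> verts G2 = {}"
    and "\<And>u v. u \<in> verts G1 \<Longrightarrow> v \<in> verts G1 \<Longrightarrow> u \<rightarrow>\<^bsub>G1\<^esub> v \<longleftrightarrow> u \<rightarrow>\<^bsub>G\<^esub> v"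
    and "\<And>u v. u \<in> verts G2 \<Longrightarrow> v \<in> verts G2 \<Longrightarrow> u \<rightarrow>\<^bsub>G2\<^esub> v \<longleftrightarrow> u \<rightarrow>\<^bsub>G\<^esub> v"
    and "\<And>u v. u \<in> verts G1 \<Longrightarrow> v \<in> verts G2 \<Longrightarrow> u \<rightarrow>\<^bsub>G\<^esub> v \<longleftrightarrow> (u, v) = (x, y)"
proof -
  let ?D = "delete_edge G x y"
  interpret D: Digraph.graph ?D by (rule graph_delete_edge)
  have sccs: "D.sccs = {G1, G2}"
    using comps D.connected_components_eq_sccs by simp
  have ind: "induced_subgraph G1 ?D" "induced_subgraph G2 ?D"
    using sccs D.in_sccs_imp_induced by auto
  show "Digraph.graph G1" "Digraph.graph G2"
    using ind by (auto intro: D.graph_induced_subgraph)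
  have "sccs = {G}"
    using conn strongly_connected_eq_iff symmetric_connected_imp_strongly_connected[OF sym_arcs]
    by blast
  then have "card (connected_components G) = 1"
    by (simp add: connected_components_eq_sccs)
  \<comment> \<open>The connected graph has one component and deleting a bridge increases the
    number, so \<open>{G1, G2}\<close> cannot be a singleton.\<close>
  then have "G1 \<noteq> G2"
    using bridge comps unfolding bridge_def by auto
  then show disj: "verts G1 \<inter> verts G2 = {}"
    using D.scc_disj[of G1 G2] sccs by simp
  have "verts ?D = verts G" by (simp add: delete_edge_def)
  moreover have "verts ?D \<subseteq> verts G1 \<union> verts G2"
  proof
    fix u assume "u \<in> verts ?D"
    then obtain H where "H \<in> D.sccs" "u \<in> verts H" using D.scc_for_vert_ex by blast
    then show "u \<in> verts G1 \<union> verts G2" using sccs by auto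
  qed
  moreover have "verts G1 \<subseteq> verts ?D" "verts G2 \<subseteq> verts ?D"
    using ind by (auto dest!: induced_imp_subgraph)
  ultimately show "verts G = verts G1 \<union> verts G2" by auto
  show "u \<rightarrow>\<^bsub>G1\<^esub> v \<longleftrightarrow> u \<rightarrow>\<^bsub>G\<^esub> v" if "u \<in> verts G1" "v \<in> verts G1" for u v
    using that disj xy
    by (auto simp: arcs_ends_induced_subgraph[OF ind(1)] arcs_ends_delete_edge)
  show "u \<rightarrow>\<^bsub>G2\<^esub> v \<longleftrightarrow> u \<rightarrow>\<^bsub>G\<^esub> v" if "u \<in> verts G2" "v \<in> verts G2" for u v
    using that disj xy
    by (auto simp: arcs_ends_induced_subgraph[OF ind(2)] arcs_ends_delete_edge)
  show "u \<rightarrow>\<^bsub>G\<^esub> v \<longleftrightarrow> (u, v) = (x, y)" if "u \<in> verts G1" "v \<in> verts G2" for u v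
  proof
    assume "u \<rightarrow>\<^bsub>G\<^esub> v"
    \<comment> \<open>A surviving crossing arc would put both ends into one component. The arc is
      therefore one of the two deleted ones, and only \<open>(x, y)\<close> leads from
      \<open>G1\<close> to \<open>G2\<close>.\<close>
    have "\<not> u \<rightarrow>\<^bsub>?D\<^esub> v"
    proof
      assume "u \<rightarrow>\<^bsub>?D\<^esub> v"
      then obtain H where "H \<in> D.sccs" "u \<in> verts H" "v \<in> verts H"
        by (rule D.adj_imp_mem_same_scc)
      then show False using sccs disj that by auto
    qed
    then show "(u, v) = (x, y)"
      using \<open>u \<rightarrow>\<^bsub>G\<^esub> v\<close> that disj xy by (auto simp: arcs_ends_delete_edge)
  qed (use bridge in \<open>auto simp: bridge_def\<close>)
qed

section \<open>From vanishing minors to the two alternatives\<close>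

text \<open>This serves the second alternative. In the minors \<open>v\<close> is removed before
  \<open>w\<close>, which is the form in which the link formula produces them.\<close>

lemma parter_graph_del_vertI:
  fixes a :: "'a \<Rightarrow> 'a \<Rightarrow> real"
  assumes G: "Digraph.graph G"
    and sym: "\<And>u v. u \<in> verts G \<Longrightarrow> v \<in> verts G \<Longrightarrow> a u v = a v u"
    and adj: "\<And>u v. u \<in> verts G \<Longrightarrow> v \<in> verts G \<Longrightarrow> u \<noteq> v \<Longrightarrow> a u v \<noteq> 0 \<longleftrightarrow> u \<rightarrow>\<^bsub>G\<^esub> v"
    and det: "det_on (verts G - {w}) a \<noteq> 0"
    and minor: "\<And>v. v \<in> verts G \<Longrightarrow> v \<noteq> w \<Longrightarrow> det_on (verts G - {v} - {w}) a = 0"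
  shows "parter_graph (pre_digraph.del_vert G w)"
proof (rule parter_graphI[where a = a])
  interpret Digraph.graph G by (rule G)
  have ind: "induced_subgraph (del_vert w) G" by (rule induced_subgraph_del_vert)
  show "Digraph.graph (del_vert w)" by (rule graph_induced_subgraph[OF ind])
  show "a u v \<noteq> 0 \<longleftrightarrow> u \<rightarrow>\<^bsub>del_vert w\<^esub> v"
    if "u \<in> verts (del_vert w)" "v \<in> verts (del_vert w)" "u \<noteq> v" for u v
    using that adj[of u v] by (auto simp: verts_del_vert arcs_ends_induced_subgraph[OF ind])
  show "det_on (verts (del_vert w) - {v}) a = 0" if "v \<in> verts (del_vert w)" for v
    using that minor[of v] by (simp add: verts_del_vert Diff_insert2[symmetric] insert_commute)
qed (use sym det in \<open>auto simp: pre_digraph.verts_del_vert\<close>)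

theorem proposition1p5:
  fixes G G1 G2 :: "('a, 'b) pre_digraph" and x y :: 'a
  assumes "parter_graph G"
    and "Digraph_Component.connected G"
    and "bridge G x y"
    and "connected_components (delete_edge G x y) = {G1, G2}"
    and "x \<in> verts G1" and "y \<in> verts G2"
  shows "(parter_graph G1 \<and> parter_graph G2) \<or>
         (parter_graph (pre_digraph.del_vert G1 x) \<and> parter_graph (pre_digraph.del_vert G2 y))"
proof -
  obtain a :: "'a \<Rightarrow> 'a \<Rightarrow> real" where G: "Digraph.graph G"
    and a: "\<forall>u\<in>verts G. \<forall>v\<in>verts G.
      a u v = a v u \<and> (u \<noteq> v \<longrightarrow> (a u v \<noteq> 0 \<longleftrightarrow> u \<rightarrow>\<^bsub>G\<^esub> v))"
    and det: "det_on (verts G) a \<noteq> 0"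
    and minors: "\<forall>v\<in>verts G. det_on (verts G - {v}) a = 0"
    using assms(1) unfolding parter_graph_iff by (elim conjE exE)
  have sym: "a u v = a v u" if "u \<in> verts G" "v \<in> verts G" for u v
    using a that by blast
  have adj: "a u v \<noteq> 0 \<longleftrightarrow> u \<rightarrow>\<^bsub>G\<^esub> v" if "u \<in> verts G" "v \<in> verts G" "u \<noteq> v" for u v
    using a that by blast
  have minor: "det_on (verts G - {v}) a = 0" if "v \<in> verts G" for v
    using minors that by blast
  interpret Digraph.graph G by (rule G)
  note comps = bridge_components[OF assms(2-6)]
  let ?S = "verts G1" and ?T = "verts G2"
  define c where "c = a x y"
  have V: "verts G = ?S \<union> ?T" and disj: "?S \<inter> ?T = {}" by (fact comps)+
  have fin: "finite ?S" "finite ?T" using finite_verts V by auto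
  have x: "x \<in> ?S" "x \<notin> ?T" and y: "y \<in> ?T" "y \<notin> ?S" using assms(5,6) disj by auto
  have zero: "a u v = 0" "a v u = 0" if "u \<in> ?S" "v \<in> ?T" "(u, v) \<noteq> (x, y)" for u v
    using adj[of u v] sym[of u v] comps(7)[of u v] that V disj by auto
  have c: "a x y = c" "a y x = c"
    using sym[of x y] x y V by (auto simp: c_def)
  \<comment> \<open>Arbitrary subsets are allowed so that one formula covers the whole graph and the
    deletion of any vertex other than \<open>x\<close> and \<open>y\<close>.\<close>
  have link: "det_on (S \<union> T) a =
      det_on S a * det_on T a - c\<^sup>2 * det_on (S - {x}) a * det_on (T - {y}) a"
    if "S \<subseteq> ?S" "T \<subseteq> ?T" "x \<in> S" "y \<in> T" for S T
    using that fin disj zero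
    by (subst det_on_single_link[where x = x and y = y])
      (auto simp: c power2_eq_square subset_iff intro: finite_subset)
  have no_link: "det_on (S \<union> T) a = det_on S a * det_on T a"
    if "S \<subseteq> ?S" "T \<subseteq> ?T" "x \<notin> S \<or> y \<notin> T" for S T
  proof (rule det_on_block_triangular)
    show "a u v = 0" if "u \<in> S" "v \<in> T" for u v
      using zero(1)[of u v] that \<open>S \<subseteq> ?S\<close> \<open>T \<subseteq> ?T\<close> \<open>x \<notin> S \<or> y \<notin> T\<close> by auto
  qed (use that fin disj in \<open>auto intro: finite_subset\<close>)
  let ?d1 = "det_on ?S a" and ?d2 = "det_on ?T a"
  let ?e1 = "det_on (?S - {x}) a" and ?e2 = "det_on (?T - {y}) a"
  have full: "?d1 * ?d2 - c\<^sup>2 * ?e1 * ?e2 \<noteq> 0"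
    using det link[of ?S ?T] x y V by simp
  have del_S: "det_on ((?S - {v}) \<union> ?T) a = 0" if "v \<in> ?S" for v
  proof -
    have "(?S - {v}) \<union> ?T = verts G - {v}" using that V disj by auto
    then show ?thesis using minor[of v] that V by simp
  qed
  have del_T: "det_on (?S \<union> (?T - {v})) a = 0" if "v \<in> ?T" for v
  proof -
    have "?S \<union> (?T - {v}) = verts G - {v}" using that V disj by auto
    then show ?thesis using minor[of v] that V by simp
  qed
  have "?e1 * ?d2 = 0"
    using del_S[of x] no_link[of "?S - {x}" ?T] x by simp
  moreover have "?d1 * ?e2 = 0"
    using del_T[of y] no_link[of ?S "?T - {y}"] y by simp
  \<comment> \<open>If \<open>?d1 * ?d2\<close> is nonzero, the two vanishing products force
    \<open>?e1\<close> and \<open>?e2\<close> to be zero. Otherwise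
    \<open>c\<^sup>2 * ?e1 * ?e2\<close> is nonzero by \<open>full\<close>, and the same products
    force \<open>?d1\<close> and \<open>?d2\<close> to be zero.\<close>
  ultimately have cases: "(?e1 = 0 \<and> ?e2 = 0 \<and> ?d1 \<noteq> 0 \<and> ?d2 \<noteq> 0) \<or>
      (?d1 = 0 \<and> ?d2 = 0 \<and> ?e1 \<noteq> 0 \<and> ?e2 \<noteq> 0 \<and> c \<noteq> 0)"
    using full by auto
  have minor_S: "det_on (?S - {v}) a * ?d2 = c\<^sup>2 * det_on (?S - {v} - {x}) a * ?e2"
    if "v \<in> ?S" "v \<noteq> x" for v
    using del_S[of v] link[of "?S - {v}" ?T] that x y by simp
  have minor_T: "?d1 * det_on (?T - {v}) a = c\<^sup>2 * ?e1 * det_on (?T - {v} - {y}) a"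
    if "v \<in> ?T" "v \<noteq> y" for v
    using del_T[of v] link[of ?S "?T - {v}"] that x y by simp
  have sym1: "a u v = a v u" if "u \<in> ?S" "v \<in> ?S" for u v
    using sym that V by simp
  have sym2: "a u v = a v u" if "u \<in> ?T" "v \<in> ?T" for u v
    using sym that V by simp
  have adj1: "a u v \<noteq> 0 \<longleftrightarrow> u \<rightarrow>\<^bsub>G1\<^esub> v" if "u \<in> ?S" "v \<in> ?S" "u \<noteq> v" for u v
    using adj comps(5) that V by simp
  have adj2: "a u v \<noteq> 0 \<longleftrightarrow> u \<rightarrow>\<^bsub>G2\<^esub> v" if "u \<in> ?T" "v \<in> ?T" "u \<noteq> v" for u v
    using adj comps(6) that V by simp
  from cases show ?thesis
  proof (elim disjE conjE)
    assume z: "?e1 = 0" "?e2 = 0" "?d1 \<noteq> 0" "?d2 \<noteq> 0"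
    \<comment> \<open>For \<open>v = x\<close> this is \<open>?e1 = 0\<close>. For other
      \<open>v\<close> the right side of \<open>minor_S\<close> vanishes with \<open>?e2\<close>,
      and \<open>?d2\<close> can be cancelled.\<close>
    have "det_on (?S - {v}) a = 0" if "v \<in> ?S" for v
      using minor_S[of v] z that by (cases "v = x") auto
    moreover have "det_on (?T - {v}) a = 0" if "v \<in> ?T" for v
      using minor_T[of v] z that by (cases "v = y") auto
    ultimately have "parter_graph G1" "parter_graph G2"
      using parter_graphI[of G1 a, OF comps(1) sym1 adj1 z(3)]
        parter_graphI[of G2 a, OF comps(2) sym2 adj2 z(4)] by blast+
    then show ?thesis by blast
  next
    assume z: "?d1 = 0" "?d2 = 0" "?e1 \<noteq> 0" "?e2 \<noteq> 0" "c \<noteq> 0"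
    \<comment> \<open>Now the left side of \<open>minor_S\<close> vanishes with \<open>?d2\<close>,
      and the nonzero \<open>c\<close> and \<open>?e2\<close> can be cancelled.\<close>
    have "det_on (?S - {v} - {x}) a = 0" if "v \<in> ?S" "v \<noteq> x" for v
      using minor_S[OF that] z by simp
    moreover have "det_on (?T - {v} - {y}) a = 0" if "v \<in> ?T" "v \<noteq> y" for v
      using minor_T[OF that] z by simp
    ultimately have "parter_graph (pre_digraph.del_vert G1 x)"
        "parter_graph (pre_digraph.del_vert G2 y)"
      using parter_graph_del_vertI[of G1 a x, OF comps(1) sym1 adj1 z(3)]
        parter_graph_del_vertI[of G2 a y, OF comps(2) sym2 adj2 z(4)] by blast+
    then show ?thesis by blast
  qed
qed

end
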